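(* For integers $i,j$ define integers $a_{i,j}(n)$, $n\ge0$, by $a_{i,j}(0)=0$ for all $i,j$; $a_{i,j}(1)=1$ if $i=j=1$ and $a_{i,j}(1)=0$ otherwise; and for $n\ge 0$ \[ a_{i,j}(n+2)=a_{i,j}(n+1)+a_{i-1,j}(n+1)+a_{i,j-1}(n+1)+a_{i-1,j-1}(n+1)+a_{i-1,j-1}(n). \] Then for every positive integer $m$, \[ P_{m,m}=\{(i,j)\in\mathbb{Z}^2 : a_{i,j}(m)\equiv 1 \pmod 2\}. \]
   Context: For a positive integer $m$, the chocolate game $C_{m,m}$ is a two-player impartial game on an $m\times m$ chocolate bar of unit cells, exactly one of which is poisoned (known to both players); cells are $(i,j)\in\mathbb{Z}^2$ with $1\le i,j\le m$. Players alternately break the current bar along a grid line into two rectangular pieces, eat one and pass the other (always keeping the poisoned cell); a player who receives the $1\times1$ bar loses. A cell is a P-position if with poison there the second player has a winning strategy; $P_{m,m}$ is the set of P-positions. It is known that $(i,j)\in P_{m,m}$ iff $1\le i,j\le m$ and $(i-1)\oplus(j-1)\oplus(m-i)\oplus(m-j)=0$ ($\oplus$ = bitwise XOR). *)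

theory Defs
  imports "HOL-Number_Theory.Cong"
begin

type_synonym cell = "int \<times> int"

definition chocolate :: "int \<Rightarrow> cell set" where
  "chocolate m = {1..m} \<times> {1..m}"

text \<open>Breaking a bar along the grid line between the coordinates \<open>k\<close> and \<open>k + 1\<close>. Nonemptiness of
  both pieces says that the line runs through the interior of the bar. Starting from a rectangle, all
  bars that arise are rectangles.\<close>

definition breaks_into :: "cell set \<Rightarrow> cell set \<Rightarrow> cell set \<Rightarrow> bool" where
  "breaks_into B A C \<longleftrightarrow> A \<noteq> {} \<and> C \<noteq> {} \<and>
     (\<exists>k. (A = {c \<in> B. fst c \<le> k} \<and> C = {c \<in> B. fst c > k}) \<or>
          (A = {c \<in> B. snd c \<le> k} \<and> C = {c \<in> B. snd c > k}))"

definition move :: "cell \<Rightarrow> cell set \<Rightarrow> cell set \<Rightarrow> bool" where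
  "move p B B' \<longleftrightarrow> p \<in> B' \<and> (\<exists>E. breaks_into B B' E \<or> breaks_into B E B')"

text \<open>A play is the list of bars received in turn: the first player receives the bars at even
  positions (counting from 0), the second player those at odd positions. A complete play ends with
  the bar \<open>{p}\<close>, and the player who receives it loses.\<close>

definition complete_play :: "cell \<Rightarrow> cell set \<Rightarrow> cell set list \<Rightarrow> bool" where
  "complete_play p B bs \<longleftrightarrow> bs \<noteq> [] \<and> hd bs = B \<and> last bs = {p} \<and>
     (\<forall>k. Suc k < length bs \<longrightarrow> move p (bs ! k) (bs ! Suc k))"

definition second_player_wins :: "cell set list \<Rightarrow> bool" where
  "second_player_wins bs \<longleftrightarrow> even (length bs - 1)"

text \<open>A strategy prescribes the reply to the current bar. It has to be legal whenever a move exists;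
  otherwise a strategy with illegal replies would win vacuously. All plays on a finite bar are finite,
  so only complete plays need to be considered.\<close>

definition strategy :: "cell \<Rightarrow> (cell set \<Rightarrow> cell set) \<Rightarrow> bool" where
  "strategy p \<sigma> \<longleftrightarrow> (\<forall>B. (\<exists>B'. move p B B') \<longrightarrow> move p B (\<sigma> B))"

definition second_player_follows :: "(cell set \<Rightarrow> cell set) \<Rightarrow> cell set list \<Rightarrow> bool" where
  "second_player_follows \<sigma> bs \<longleftrightarrow>
     (\<forall>k. odd k \<and> Suc k < length bs \<longrightarrow> bs ! Suc k = \<sigma> (bs ! k))"

definition winning_for_second :: "cell \<Rightarrow> cell set \<Rightarrow> (cell set \<Rightarrow> cell set) \<Rightarrow> bool" where
  "winning_for_second p B \<sigma> \<longleftrightarrow> strategy p \<sigma> \<and>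
     (\<forall>bs. complete_play p B bs \<and> second_player_follows \<sigma> bs \<longrightarrow> second_player_wins bs)"

definition P_positions :: "int \<Rightarrow> cell set" where
  "P_positions m = {p \<in> chocolate m. \<exists>\<sigma>. winning_for_second p (chocolate m) \<sigma>}"

fun a :: "nat \<Rightarrow> int \<Rightarrow> int \<Rightarrow> int" where
  "a 0 i j = 0"
| "a (Suc 0) i j = (if i = 1 \<and> j = 1 then 1 else 0)"
| "a (Suc (Suc n)) i j =
     a (Suc n) i j + a (Suc n) (i - 1) j + a (Suc n) i (j - 1) + a (Suc n) (i - 1) (j - 1)
       + a n (i - 1) (j - 1)"

end

theory Submission
  imports Defs
begin

text \<open>The four distances from the poisoned cell to the sides of the bar behave like Nim heaps: a move
  shortens exactly one of them. Hence the P-positions are given by Nim-sum zero.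

  For the coefficients, let \<open>A n\<close> be the generating polynomial of the numbers \<open>a n (i + 1) (j + 1)\<close>, so that
  \<open>A (n + 2) = (1 + x) (1 + y) A (n + 1) + x y A n\<close>. Since squaring is additive modulo 2, induction gives
  \<open>A (2 n) = (1 + x) (1 + y) A n (x\<^sup>2, y\<^sup>2)\<close> and
  \<open>A (2 n + 1) = A (n + 1) (x\<^sup>2, y\<^sup>2) + x y A n (x\<^sup>2, y\<^sup>2)\<close> modulo 2.
  Read coefficientwise, this is the recursion that the Nim-sum condition
  satisfies when the last binary digits are removed.\<close>

section \<open>Nim-sums of four heaps\<close>

unbundle bit_operations_syntax

lemma xor_div_2: "(x XOR y) div 2 = (x div 2) XOR (y div 2)" for x y :: int
  by (rule bit_eqI) (simp add: bit_xor_iff flip: bit_Suc)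

definition nim_sum :: "int \<Rightarrow> int \<Rightarrow> int \<Rightarrow> int \<Rightarrow> int" where
  "nim_sum w x y z = (w XOR x) XOR (y XOR z)"

lemma nim_sum_div_2: "nim_sum w x y z div 2 = nim_sum (w div 2) (x div 2) (y div 2) (z div 2)"
  by (simp add: nim_sum_def xor_div_2)

lemma even_nim_sum_iff: "even (nim_sum w x y z) \<longleftrightarrow> even (w + x + y + z)"
  by (auto simp: nim_sum_def even_xor_iff)

text \<open>Splits off the last binary digit of the Nim-sum. This is the form in which the zero
  condition meets the halving recursion of the coefficients.\<close>

lemma nim_sum_eq_0_iff:
  "nim_sum w x y z = 0 \<longleftrightarrow>
     even (w + x + y + z) \<and> nim_sum (w div 2) (x div 2) (y div 2) (z div 2) = 0"
proof -
  have "nim_sum w x y z = 0 \<longleftrightarrow> even (nim_sum w x y z) \<and> nim_sum w x y z div 2 = 0"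
    by presburger
  then show ?thesis
    by (simp add: even_nim_sum_iff nim_sum_div_2)
qed

lemma nim_sum_nonneg:
  "\<lbrakk>0 \<le> w; 0 \<le> x; 0 \<le> y; 0 \<le> z\<rbrakk> \<Longrightarrow> 0 \<le> nim_sum w x y z"
  by (simp add: nim_sum_def)

lemma xor_self_left: "k XOR (k XOR u) = u" for k u :: int
  by (simp flip: xor.assoc)

lemma xor_cancel: "k XOR u = k XOR v \<longleftrightarrow> u = v" "u XOR k = v XOR k \<longleftrightarrow> u = v" for k u v :: int
  by (metis xor_self_left xor.commute)+

text \<open>XOR with a fixed number is injective, so changing a single heap changes the Nim-sum.
  Hence no move leads from sum zero to sum zero.\<close>

lemma nim_sum_inj:
  "nim_sum w x y z = nim_sum w' x y z \<longleftrightarrow> w = w'"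
  "nim_sum w x y z = nim_sum w x' y z \<longleftrightarrow> x = x'"
  "nim_sum w x y z = nim_sum w x y' z \<longleftrightarrow> y = y'"
  "nim_sum w x y z = nim_sum w x y z' \<longleftrightarrow> z = z'"
  by (simp_all add: nim_sum_def xor_cancel)

text \<open>These are the heap sizes for the winning reply in Nim;
  \<open>exists_heap_xor_less\<close> provides a heap for which the new size is smaller.\<close>

lemma nim_sum_reduce:
  fixes w x y z :: int
  defines "s \<equiv> nim_sum w x y z"
  shows "nim_sum (w XOR s) x y z = 0" "nim_sum w (x XOR s) y z = 0"
    "nim_sum w x (y XOR s) z = 0" "nim_sum w x y (z XOR s) = 0"
  by (simp_all add: s_def nim_sum_def ac_simps xor_self_left)

lemma xor_less_if_div_2:
  "(w div 2) XOR (s div 2) < w div 2 \<Longrightarrow> w XOR s < w" for w s :: int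
  unfolding xor_div_2[symmetric] by presburger

text \<open>The leading binary digit of \<open>s\<close> occurs in some heap, and XOR with
  \<open>s\<close> clears it there without touching higher digits. The induction removes last digits
  until \<open>s = 1\<close>; then some heap is odd, and XOR with 1 decreases it. A decrease of the
  halves lifts to the numbers themselves.\<close>

lemma exists_heap_xor_less:
  "nim_sum w x y z = s \<Longrightarrow> 0 < s \<Longrightarrow>
     w XOR s < w \<or> x XOR s < x \<or> y XOR s < y \<or> z XOR s < z"
proof (induction "nat s" arbitrary: w x y z s rule: less_induct)
  case less
  show ?case
  proof (cases "s = 1")
    case True
    then have "odd w \<or> odd x \<or> odd y \<or> odd z"
      using less.prems even_nim_sum_iff[of w x y z] by auto
    moreover have "k XOR 1 < k" if "odd k" for k :: int
      using that by (simp add: xor_one_eq)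
    ultimately show ?thesis
      using True by blast
  next
    case False
    with less.prems have "0 < s div 2" "nat (s div 2) < nat s"
      by auto
    moreover have "nim_sum (w div 2) (x div 2) (y div 2) (z div 2) = s div 2"
      using less.prems by (simp flip: nim_sum_div_2)
    ultimately show ?thesis
      using less.hyps xor_less_if_div_2 by blast
  qed
qed

section \<open>Plays and winning strategies\<close>

lemma move_psubset:
  assumes "move p B B'"
  shows "B' \<subset> B"
proof -
  have "A \<subset> B \<and> C \<subset> B" if "breaks_into B A C" for A C
  proof -
    have "A \<union> C = B" "A \<inter> C = {}" "A \<noteq> {}" "C \<noteq> {}"
      using that unfolding breaks_into_def by auto
    then show ?thesis
      by blast
  qed
  then show ?thesis
    using assms unfolding move_def by blast
qed

lemma move_from_singleton: "\<not> move p {p} B'"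
  by (metis move_psubset move_def psubset_imp_ex_mem singletonD subset_singletonD psubsetE empty_iff)

lemma complete_play_Cons:
  "move p B (hd bs) \<Longrightarrow> complete_play p (hd bs) bs \<Longrightarrow> complete_play p B (B # bs)"
  by (auto simp: complete_play_def nth_Cons hd_conv_nth split: nat.splits)

text \<open>The kernel argument for finite games: \<open>I\<close> is an invariant of the reachable
  bars and \<open>Z\<close> the candidate for the set of lost bars. From \<open>Z\<close> the second
  player can always return to \<open>Z\<close>; from outside \<open>Z\<close> the first player moves
  into \<open>Z\<close> and takes over that role.\<close>

lemma exists_winning_for_second_iff:
  assumes init: "I B" and fin: "finite B"
    and closed: "\<And>B B'. \<lbrakk>I B; move p B B'\<rbrakk> \<Longrightarrow> I B'"
    and leave: "\<And>B B'. \<lbrakk>I B; Z B; move p B B'\<rbrakk> \<Longrightarrow> \<not> Z B'"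
    and enter: "\<And>B. \<lbrakk>I B; \<not> Z B\<rbrakk> \<Longrightarrow> \<exists>B'. move p B B' \<and> Z B'"
    and final: "\<And>B. \<lbrakk>I B; \<nexists>B'. move p B B'\<rbrakk> \<Longrightarrow> B = {p}"
  shows "(\<exists>\<sigma>. winning_for_second p B \<sigma>) \<longleftrightarrow> Z B"
proof
  assume Z: "Z B"
  \<comment> \<open>The second alternative keeps replies legal on bars without a move into
    \<open>Z\<close>, as \<open>strategy\<close> demands legality on every bar with a move.\<close>
  define \<sigma> where "\<sigma> B = (if \<exists>B'. move p B B' \<and> Z B' then SOME B'. move p B B' \<and> Z B'
      else SOME B'. move p B B')" for B
  have \<sigma>: "move p B (\<sigma> B)" if "\<exists>B'. move p B B'" for B
    using that unfolding \<sigma>_def by (smt (verit) someI_ex)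
  have \<sigma>Z: "Z (\<sigma> B)" if "I B" "\<not> Z B" for B
    using enter[OF that] unfolding \<sigma>_def by (smt (verit) someI_ex)
  have "second_player_wins bs"
    if play: "complete_play p B bs" and follows: "second_player_follows \<sigma> bs" for bs
  proof -
    have inv: "I (bs ! k) \<and> (Z (bs ! k) \<longleftrightarrow> even k)" if "k < length bs" for k
      using that
    proof (induction k)
      case 0
      then show ?case
        using play Z init by (simp add: complete_play_def hd_conv_nth)
    next
      case (Suc k)
      then have step: "move p (bs ! k) (bs ! Suc k)"
        using play by (simp add: complete_play_def)
      have "bs ! Suc k = \<sigma> (bs ! k)" if "odd k"
        using follows that Suc.prems by (simp add: second_player_follows_def)
      with step Suc show ?case
        using closed leave \<sigma>Z by (metis Suc_lessD even_Suc)
    qed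
    \<comment> \<open>No move leaves \<open>{p}\<close>, so \<open>enter\<close> forces
      \<open>Z {p}\<close>; by the invariant the last index is even.\<close>
    have "bs ! (length bs - 1) = {p}" "bs \<noteq> []"
      using play by (auto simp: complete_play_def last_conv_nth)
    then show ?thesis
      using inv[of "length bs - 1"] enter[of "{p}"] move_from_singleton
      by (auto simp: second_player_wins_def)
  qed
  then show "\<exists>\<sigma>. winning_for_second p B \<sigma>"
    using \<sigma> unfolding winning_for_second_def strategy_def by blast
next
  assume "\<exists>\<sigma>. winning_for_second p B \<sigma>"
  then obtain \<sigma> where \<sigma>: "winning_for_second p B \<sigma>" ..
  \<comment> \<open>Against the given strategy a play lost by the second player is built by
    induction on the bar. Each round puts two bars in front, which preserves both the parity of the
    length and the positions at which \<open>\<sigma>\<close> replies.\<close>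
  have lost: "\<exists>bs. complete_play p B bs \<and> second_player_follows \<sigma> bs \<and> even (length bs)"
    if "finite B" "I B" "\<not> Z B" for B
    using that
  proof (induction B rule: finite_psubset_induct)
    case (psubset B)
    obtain B' where B': "move p B B'" "Z B'"
      using enter psubset.prems by blast
    have "I B'"
      using closed psubset.prems B' by blast
    show ?case
    proof (cases "\<exists>C. move p B' C")
      case False
      then have "B' = {p}"
        using final \<open>I B'\<close> by blast
      then show ?thesis
        using B' by (intro exI[of _ "[B, B']"])
          (auto simp: complete_play_def second_player_follows_def)
    next
      case True
      then have reply: "move p B' (\<sigma> B')"
        using \<sigma> by (auto simp: winning_for_second_def strategy_def)
      then have "\<sigma> B' \<subset> B" "I (\<sigma> B')" "\<not> Z (\<sigma> B')"
        using move_psubset[OF reply] move_psubset[OF B'(1)] closed leave \<open>I B'\<close> B' by blast+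
      then obtain bs where bs: "complete_play p (\<sigma> B') bs" "second_player_follows \<sigma> bs"
          "even (length bs)"
        using psubset.IH by blast
      then have hd: "hd bs = \<sigma> B'" "bs \<noteq> []"
        by (auto simp: complete_play_def)
      have "complete_play p B (B # B' # bs)"
        using complete_play_Cons[of p B' bs] complete_play_Cons[of p B "B' # bs"] bs hd reply B'
        by simp
      moreover have "second_player_follows \<sigma> (B # B' # bs)"
        using bs hd unfolding second_player_follows_def
        by (auto simp: nth_Cons hd_conv_nth split: nat.splits)
      ultimately show ?thesis
        using bs by (intro exI[of _ "B # B' # bs"]) auto
    qed
  qed
  show "Z B"
  proof (rule ccontr)
    assume "\<not> Z B"
    with lost fin init obtain bs where bs: "complete_play p B bs"
        "second_player_follows \<sigma> bs" "even (length bs)"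
      by blast
    \<comment> \<open>A complete play is nonempty, so the truncated subtraction really changes the
      parity of the length.\<close>
    then have "even (length bs - 1)"
      using \<sigma> by (auto simp: winning_for_second_def second_player_wins_def)
    with bs show False
      by (cases bs) (auto simp: complete_play_def)
  qed
qed

section \<open>Rectangular bars and the game on them\<close>

definition bar :: "int \<Rightarrow> int \<Rightarrow> int \<Rightarrow> int \<Rightarrow> cell set" where
  "bar l r t b = {l..r} \<times> {t..b}"

lemma mem_bar: "(i, j) \<in> bar l r t b \<longleftrightarrow> l \<le> i \<and> i \<le> r \<and> t \<le> j \<and> j \<le> b"
  by (auto simp: bar_def)

text \<open>The member \<open>(i, j)\<close> excludes the empty bar, whose sides are not determined
  by the set.\<close>

lemma bar_eq_iff:
  "(i, j) \<in> bar l r t b \<Longrightarrow>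
     bar l r t b = bar l' r' t' b' \<longleftrightarrow> l = l' \<and> r = r' \<and> t = t' \<and> b = b'"
  by (auto simp: bar_def times_eq_iff)

lemma bar_split:
  "{c \<in> bar l r t b. fst c \<le> k} = bar l (min r k) t b"
  "{c \<in> bar l r t b. fst c > k} = bar (max l (k + 1)) r t b"
  "{c \<in> bar l r t b. snd c \<le> k} = bar l r t (min b k)"
  "{c \<in> bar l r t b. snd c > k} = bar l r (max t (k + 1)) b"
  by (auto simp: bar_def)

lemma bar_eq_empty_iff: "bar l r t b = {} \<longleftrightarrow> r < l \<or> b < t"
  by (auto simp: bar_def)

lemma breaks_into_bar_fst:
  "\<lbrakk>l \<le> k; k < r; t \<le> b\<rbrakk> \<Longrightarrow> breaks_into (bar l r t b) (bar l k t b) (bar (k + 1) r t b)"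
  unfolding breaks_into_def bar_split
  by (intro conjI exI[of _ k] disjI1) (simp_all add: bar_eq_empty_iff)

lemma breaks_into_bar_snd:
  "\<lbrakk>t \<le> k; k < b; l \<le> r\<rbrakk> \<Longrightarrow> breaks_into (bar l r t b) (bar l r t k) (bar l r (k + 1) b)"
  unfolding breaks_into_def bar_split
  by (intro conjI exI[of _ k] disjI2) (simp_all add: bar_eq_empty_iff)

text \<open>The grid line in \<open>breaks_into\<close> is arbitrary; nonemptiness of both pieces
  places it inside the bar, which removes the \<open>min\<close> and \<open>max\<close> from
  \<open>bar_split\<close>.\<close>

lemma breaks_into_barE:
  assumes "breaks_into (bar l r t b) A C"
  obtains k where "l \<le> k" "k < r" "A = bar l k t b" "C = bar (k + 1) r t b"
  | k where "t \<le> k" "k < b" "A = bar l r t k" "C = bar l r (k + 1) b"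
proof -
  from assms have ne: "A \<noteq> {}" "C \<noteq> {}"
    by (simp_all add: breaks_into_def)
  from assms have "\<exists>k. (A = bar l (min r k) t b \<and> C = bar (max l (k + 1)) r t b) \<or>
      (A = bar l r t (min b k) \<and> C = bar l r (max t (k + 1)) b)"
    unfolding breaks_into_def bar_split by (elim conjE)
  then obtain k where "A = bar l (min r k) t b \<and> C = bar (max l (k + 1)) r t b \<or>
      A = bar l r t (min b k) \<and> C = bar l r (max t (k + 1)) b" ..
  then show ?thesis
  proof (elim disjE conjE)
    assume AC: "A = bar l (min r k) t b" "C = bar (max l (k + 1)) r t b"
    with ne have "l \<le> k" "k < r"
      by (simp_all add: bar_eq_empty_iff)
    with AC show ?thesis
      by (intro that(1)[of k]) simp_all
  next
    assume AC: "A = bar l r t (min b k)" "C = bar l r (max t (k + 1)) b"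
    with ne have "t \<le> k" "k < b"
      by (simp_all add: bar_eq_empty_iff)
    with AC show ?thesis
      by (intro that(2)[of k]) simp_all
  qed
qed

text \<open>Keeping the poisoned cell leaves one side free to move inwards, at most up to that cell.
  In terms of the four distances this is exactly a Nim move.\<close>

lemma move_bar_iff:
  assumes "(i, j) \<in> bar l r t b"
  shows "move (i, j) (bar l r t b) B' \<longleftrightarrow>
    (\<exists>l'. l < l' \<and> l' \<le> i \<and> B' = bar l' r t b) \<or>
    (\<exists>r'. i \<le> r' \<and> r' < r \<and> B' = bar l r' t b) \<or>
    (\<exists>t'. t < t' \<and> t' \<le> j \<and> B' = bar l r t' b) \<or>
    (\<exists>b'. j \<le> b' \<and> b' < b \<and> B' = bar l r t b')" (is "?L \<longleftrightarrow> ?R")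
proof
  assume mv: ?L
  then have mem: "(i, j) \<in> B'"
    by (simp add: move_def)
  from mv obtain E where "breaks_into (bar l r t b) B' E \<or> breaks_into (bar l r t b) E B'"
    by (auto simp: move_def)
  then show ?R
  proof
    assume "breaks_into (bar l r t b) B' E"
    then show ?R
      by (rule breaks_into_barE) (use mem in \<open>force simp: mem_bar\<close>)+
  next
    assume "breaks_into (bar l r t b) E B'"
    then show ?R
    proof (rule breaks_into_barE)
      fix k assume "l \<le> k" "k < r" "B' = bar (k + 1) r t b"
      with mem have "l < k + 1 \<and> k + 1 \<le> i \<and> B' = bar (k + 1) r t b"
        by (simp add: mem_bar)
      then show ?R
        by blast
    next
      fix k assume "t \<le> k" "k < b" "B' = bar l r (k + 1) b"
      with mem have "t < k + 1 \<and> k + 1 \<le> j \<and> B' = bar l r (k + 1) b"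
        by (simp add: mem_bar)
      then show ?R
        by blast
    qed
  qed
next
  assume ?R
  then show ?L
  proof (elim disjE exE conjE)
    fix l' assume "l < l'" "l' \<le> i" "B' = bar l' r t b"
    with assms show ?L
      using breaks_into_bar_fst[of l "l' - 1" r t b] by (auto simp: move_def mem_bar)
  next
    fix r' assume "i \<le> r'" "r' < r" "B' = bar l r' t b"
    with assms show ?L
      using breaks_into_bar_fst[of l r' r t b] by (auto simp: move_def mem_bar)
  next
    fix t' assume "t < t'" "t' \<le> j" "B' = bar l r t' b"
    with assms show ?L
      using breaks_into_bar_snd[of t "t' - 1" b l r] by (auto simp: move_def mem_bar)
  next
    fix b' assume "j \<le> b'" "b' < b" "B' = bar l r t b'"
    with assms show ?L
      using breaks_into_bar_snd[of t b' b l r] by (auto simp: move_def mem_bar)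
  qed
qed

lemma winning_on_bar_iff:
  assumes mem: "(i, j) \<in> bar l r t b"
  shows "(\<exists>\<sigma>. winning_for_second (i, j) (bar l r t b) \<sigma>) \<longleftrightarrow>
    nim_sum (i - l) (r - i) (j - t) (b - j) = 0"
proof -
  define I where "I B \<longleftrightarrow> (\<exists>l r t b. B = bar l r t b \<and> (i, j) \<in> B)" for B
  \<comment> \<open>\<open>Z\<close> has to be a predicate on sets, so the sides are quantified;
    \<open>Z_bar\<close> recovers them because the bar is nonempty.\<close>
  define Z where "Z B \<longleftrightarrow> (\<exists>l r t b. B = bar l r t b \<and> (i, j) \<in> B \<and>
    nim_sum (i - l) (r - i) (j - t) (b - j) = 0)" for B
  have Z_bar: "Z (bar l r t b) \<longleftrightarrow> nim_sum (i - l) (r - i) (j - t) (b - j) = 0"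
    if "(i, j) \<in> bar l r t b" for l r t b
    using that by (auto simp: Z_def bar_eq_iff[OF that])
  have "(\<exists>\<sigma>. winning_for_second (i, j) (bar l r t b) \<sigma>) \<longleftrightarrow> Z (bar l r t b)"
  proof (rule exists_winning_for_second_iff[where I = I])
    show "I (bar l r t b)" "finite (bar l r t b)"
      using mem by (auto simp: I_def bar_def)
  next
    fix B B'
    assume "I B" and mv: "move (i, j) B B'"
    then obtain l r t b where B: "B = bar l r t b" and mem: "(i, j) \<in> bar l r t b"
      by (auto simp: I_def)
    have mem': "(i, j) \<in> B'"
      using mv by (simp add: move_def)
    show "I B'"
      using mv mem' unfolding B move_bar_iff[OF mem] I_def by blast
    assume "Z B"
    then have 0: "nim_sum (i - l) (r - i) (j - t) (b - j) = 0"
      using Z_bar mem B by blast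
    show "\<not> Z B'"
    proof
      assume "Z B'"
      show False
        using mv unfolding B move_bar_iff[OF mem]
      proof (elim disjE exE conjE)
        fix l' assume "l < l'" and B': "B' = bar l' r t b"
        \<comment> \<open>Both sums are zero, so injectivity in the changed heap gives
          \<open>l' = l\<close>, a contradiction. The other three sides are treated alike.\<close>
        have "nim_sum (i - l') (r - i) (j - t) (b - j) = nim_sum (i - l) (r - i) (j - t) (b - j)"
          using \<open>Z B'\<close> Z_bar[OF mem'[unfolded B']] 0 by (simp add: B')
        with \<open>l < l'\<close> show False
          by (simp add: nim_sum_inj)
      next
        fix r' assume "r' < r" and B': "B' = bar l r' t b"
        have "nim_sum (i - l) (r' - i) (j - t) (b - j) = nim_sum (i - l) (r - i) (j - t) (b - j)"
          using \<open>Z B'\<close> Z_bar[OF mem'[unfolded B']] 0 by (simp add: B')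
        with \<open>r' < r\<close> show False
          by (simp add: nim_sum_inj)
      next
        fix t' assume "t < t'" and B': "B' = bar l r t' b"
        have "nim_sum (i - l) (r - i) (j - t') (b - j) = nim_sum (i - l) (r - i) (j - t) (b - j)"
          using \<open>Z B'\<close> Z_bar[OF mem'[unfolded B']] 0 by (simp add: B')
        with \<open>t < t'\<close> show False
          by (simp add: nim_sum_inj)
      next
        fix b' assume "b' < b" and B': "B' = bar l r t b'"
        have "nim_sum (i - l) (r - i) (j - t) (b' - j) = nim_sum (i - l) (r - i) (j - t) (b - j)"
          using \<open>Z B'\<close> Z_bar[OF mem'[unfolded B']] 0 by (simp add: B')
        with \<open>b' < b\<close> show False
          by (simp add: nim_sum_inj)
      qed
    qed
  next
    fix B
    assume "I B" "\<not> Z B"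
    then obtain l r t b where B: "B = bar l r t b" and mem: "(i, j) \<in> bar l r t b"
      by (auto simp: I_def)
    define s where "s = nim_sum (i - l) (r - i) (j - t) (b - j)"
    have nonneg: "0 \<le> i - l" "0 \<le> r - i" "0 \<le> j - t" "0 \<le> b - j"
      using mem by (auto simp: mem_bar)
    have "s \<noteq> 0"
      using \<open>\<not> Z B\<close> mem Z_bar by (simp add: B s_def)
    then have s: "0 < s"
      using nim_sum_nonneg[OF nonneg] by (simp add: s_def)
    \<comment> \<open>Nonnegative new distances mean that the shortened bar still contains the
      poisoned cell.\<close>
    have nonneg': "0 \<le> (i - l) XOR s" "0 \<le> (r - i) XOR s" "0 \<le> (j - t) XOR s" "0 \<le> (b - j) XOR s"
      using s nonneg by simp_all
    note red = nim_sum_reduce[of "i - l" "r - i" "j - t" "b - j", folded s_def]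
    consider "(i - l) XOR s < i - l" | "(r - i) XOR s < r - i"
      | "(j - t) XOR s < j - t" | "(b - j) XOR s < b - j"
      using exists_heap_xor_less[OF s_def[symmetric] s] by blast
    then obtain B' where "move (i, j) B B'" "Z B'"
    proof cases
      case 1
      \<comment> \<open>The side is placed so that its distance to the poisoned cell becomes
        \<open>(i - l) XOR s\<close>; the witnesses in the other cases arise in the same
        way.\<close>
      let ?l = "i - ((i - l) XOR s)"
      have *: "(i, j) \<in> bar ?l r t b" "l < ?l" "?l \<le> i"
        using mem 1 nonneg'(1) by (simp_all add: mem_bar)
      then have "move (i, j) B (bar ?l r t b)"
        unfolding B move_bar_iff[OF mem] by blast
      moreover have "Z (bar ?l r t b)"
        using Z_bar[OF *(1)] red(1) by simp
      ultimately show ?thesis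
        by (rule that)
    next
      case 2
      let ?r = "i + ((r - i) XOR s)"
      have *: "(i, j) \<in> bar l ?r t b" "?r < r" "i \<le> ?r"
        using mem 2 nonneg'(2) by (simp_all add: mem_bar)
      then have "move (i, j) B (bar l ?r t b)"
        unfolding B move_bar_iff[OF mem] by blast
      moreover have "Z (bar l ?r t b)"
        using Z_bar[OF *(1)] red(2) by simp
      ultimately show ?thesis
        by (rule that)
    next
      case 3
      let ?t = "j - ((j - t) XOR s)"
      have *: "(i, j) \<in> bar l r ?t b" "t < ?t" "?t \<le> j"
        using mem 3 nonneg'(3) by (simp_all add: mem_bar)
      then have "move (i, j) B (bar l r ?t b)"
        unfolding B move_bar_iff[OF mem] by blast
      moreover have "Z (bar l r ?t b)"
        using Z_bar[OF *(1)] red(3) by simp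
      ultimately show ?thesis
        by (rule that)
    next
      case 4
      let ?b = "j + ((b - j) XOR s)"
      have *: "(i, j) \<in> bar l r t ?b" "?b < b" "j \<le> ?b"
        using mem 4 nonneg'(4) by (simp_all add: mem_bar)
      then have "move (i, j) B (bar l r t ?b)"
        unfolding B move_bar_iff[OF mem] by blast
      moreover have "Z (bar l r t ?b)"
        using Z_bar[OF *(1)] red(4) by simp
      ultimately show ?thesis
        by (rule that)
    qed
    then show "\<exists>B'. move (i, j) B B' \<and> Z B'"
      by blast
  next
    fix B
    assume "I B" and nomove: "\<nexists>B'. move (i, j) B B'"
    then obtain l r t b where B: "B = bar l r t b" and mem: "(i, j) \<in> bar l r t b"
      by (auto simp: I_def)
    have "\<not> l < i" "\<not> i < r" "\<not> t < j" "\<not> j < b"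
      using nomove unfolding B move_bar_iff[OF mem] by blast+
    then show "B = {(i, j)}"
      using mem by (auto simp: B bar_def)
  qed
  then show ?thesis
    using Z_bar[OF mem] by simp
qed

lemma P_positions_iff:
  "(i, j) \<in> P_positions m \<longleftrightarrow>
     i \<in> {1..m} \<and> j \<in> {1..m} \<and> nim_sum (i - 1) (m - i) (j - 1) (m - j) = 0"
  using winning_on_bar_iff[of i j 1 m 1 m]
  by (auto simp: P_positions_def chocolate_def bar_def)

section \<open>Parity of the coefficients\<close>

definition odd_coeff :: "nat \<Rightarrow> int \<Rightarrow> int \<Rightarrow> bool" where
  "odd_coeff n i j \<longleftrightarrow> odd (a n (i + 1) (j + 1))"

text \<open>Inequality of truth values is addition modulo 2. The index shift in
  \<open>odd_coeff\<close> puts the initial odd coefficient at the origin, which is fixed by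
  doubling.\<close>

lemma odd_coeff_rec:
  "odd_coeff 0 i j = False"
  "odd_coeff (Suc 0) i j \<longleftrightarrow> i = 0 \<and> j = 0"
  "odd_coeff (Suc (Suc n)) i j =
     (((odd_coeff (Suc n) i j \<noteq> odd_coeff (Suc n) (i - 1) j) \<noteq>
       (odd_coeff (Suc n) i (j - 1) \<noteq> odd_coeff (Suc n) (i - 1) (j - 1))) \<noteq>
       odd_coeff n (i - 1) (j - 1))"
  by (auto simp: odd_coeff_def)

text \<open>The two squaring identities, one equation for each parity of the index and of both
  exponents. All eight are proved simultaneously, since each new index refers to the two preceding
  ones, of opposite parities.\<close>

lemma odd_coeff_double:
  "odd_coeff (2 * n) (2 * i) (2 * j) = odd_coeff n i j"
  "odd_coeff (2 * n) (2 * i + 1) (2 * j) = odd_coeff n i j"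
  "odd_coeff (2 * n) (2 * i) (2 * j + 1) = odd_coeff n i j"
  "odd_coeff (2 * n) (2 * i + 1) (2 * j + 1) = odd_coeff n i j"
  "odd_coeff (Suc (2 * n)) (2 * i) (2 * j) = odd_coeff (Suc n) i j"
  "odd_coeff (Suc (2 * n)) (2 * i + 1) (2 * j) = False"
  "odd_coeff (Suc (2 * n)) (2 * i) (2 * j + 1) = False"
  "odd_coeff (Suc (2 * n)) (2 * i + 1) (2 * j + 1) = odd_coeff n i j"
proof (induction n arbitrary: i j and i j and i j and i j and i j and i j and i j and i j)
  case 0
  have "2 * k + 1 \<noteq> 0" for k :: int
    by presburger
  then show "odd_coeff (2 * 0) (2 * i) (2 * j) = odd_coeff 0 i j"
    "odd_coeff (2 * 0) (2 * i + 1) (2 * j) = odd_coeff 0 i j"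
    "odd_coeff (2 * 0) (2 * i) (2 * j + 1) = odd_coeff 0 i j"
    "odd_coeff (2 * 0) (2 * i + 1) (2 * j + 1) = odd_coeff 0 i j"
    "odd_coeff (Suc (2 * 0)) (2 * i) (2 * j) = odd_coeff (Suc 0) i j"
    "odd_coeff (Suc (2 * 0)) (2 * i + 1) (2 * j) = False"
    "odd_coeff (Suc (2 * 0)) (2 * i) (2 * j + 1) = False"
    "odd_coeff (Suc (2 * 0)) (2 * i + 1) (2 * j + 1) = odd_coeff 0 i j" for i j
    by (simp_all add: odd_coeff_rec)
next
  case (Suc n)
  have pred: "2 * k - 1 = 2 * (k - 1) + 1" "2 * k + 1 - 1 = 2 * k" for k :: int
    by simp_all
  have dbl: "2 * Suc n = Suc (Suc (2 * n))"
    by simp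
  \<comment> \<open>The instance at \<open>n\<close> expands the right-hand side for index
    \<open>Suc (Suc n)\<close>. After substitution only Boolean identities remain, in which equal
    terms cancel in pairs.\<close>
  note rec = odd_coeff_rec(3)[of "2 * n"] odd_coeff_rec(3)[of "Suc (2 * n)"] odd_coeff_rec(3)[of n]
  show even: "odd_coeff (2 * Suc n) (2 * i) (2 * j) = odd_coeff (Suc n) i j"
    "odd_coeff (2 * Suc n) (2 * i + 1) (2 * j) = odd_coeff (Suc n) i j"
    "odd_coeff (2 * Suc n) (2 * i) (2 * j + 1) = odd_coeff (Suc n) i j"
    "odd_coeff (2 * Suc n) (2 * i + 1) (2 * j + 1) = odd_coeff (Suc n) i j" for i j
    by (simp_all only: dbl rec pred Suc.IH; argo)+
  show "odd_coeff (Suc (2 * Suc n)) (2 * i) (2 * j) = odd_coeff (Suc (Suc n)) i j"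
    "odd_coeff (Suc (2 * Suc n)) (2 * i + 1) (2 * j) = False"
    "odd_coeff (Suc (2 * Suc n)) (2 * i) (2 * j + 1) = False"
    "odd_coeff (Suc (2 * Suc n)) (2 * i + 1) (2 * j + 1) = odd_coeff (Suc n) i j" for i j
    by (simp_all only: dbl rec pred Suc.IH even[unfolded dbl]; argo)+
qed

lemma odd_coeff_even: "odd_coeff (2 * n) i j = odd_coeff n (i div 2) (j div 2)"
  by (cases "even i"; cases "even j"; elim evenE oddE; simp add: odd_coeff_double)

lemma odd_coeff_odd:
  "odd_coeff (Suc (2 * n)) i j \<longleftrightarrow>
     (even i \<longleftrightarrow> even j) \<and> odd_coeff (if even i then Suc n else n) (i div 2) (j div 2)"
  by (cases "even i"; cases "even j"; elim evenE oddE; simp add: odd_coeff_double)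

text \<open>Strong induction by halving all four heaps. Each coordinate and its complement to
  \<open>m - 1\<close> have halves that are again complementary, to a number determined by the
  parities; this selects the smaller index for the induction hypothesis.\<close>

lemma odd_coeff_iff_nim_sum:
  "odd_coeff m i j \<longleftrightarrow> i \<in> {0..<int m} \<and> j \<in> {0..<int m} \<and>
     nim_sum i (int m - 1 - i) j (int m - 1 - j) = 0"
proof (induction m arbitrary: i j rule: less_induct)
  case (less m)
  define i' j' where "i' = i div 2" and "j' = j div 2"
  \<comment> \<open>The case \<open>m = 1\<close> is separate because an odd index
    \<open>2 * n + 1\<close> may lead to \<open>Suc n\<close>, which is smaller only for
    \<open>0 < n\<close>.\<close>
  consider "m = 0" | "m = 1" | n where "m = 2 * n" "0 < n" | n where "m = Suc (2 * n)" "0 < n"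
    by (metis One_nat_def Suc_eq_plus1 evenE gr0I mult_0_right oddE)
  then show ?case
  proof cases
    case 1
    then show ?thesis
      by (simp add: odd_coeff_rec)
  next
    case 2
    then show ?thesis
      by (auto simp: odd_coeff_rec nim_sum_def)
  next
    case (3 n)
    have "(int m - 1 - i) div 2 = int n - 1 - i'" "(int m - 1 - j) div 2 = int n - 1 - j'"
      "even (i + (int m - 1 - i) + j + (int m - 1 - j))"
      "i \<in> {0..<int m} \<longleftrightarrow> i' \<in> {0..<int n}" "j \<in> {0..<int m} \<longleftrightarrow> j' \<in> {0..<int n}"
      using 3 unfolding i'_def j'_def atLeastLessThan_iff by presburger+
    then show ?thesis
      using less.IH[of n i' j'] 3
      by (simp add: odd_coeff_even nim_sum_eq_0_iff[of i] flip: i'_def j'_def)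
  next
    case (4 n)
    have par: "even (i + (int m - 1 - i) + j + (int m - 1 - j))"
      using 4 by presburger
    consider (mixed) "even i \<noteq> even j" | (even) "even i" "even j" | (odd) "odd i" "odd j"
      by blast
    then show ?thesis
    proof cases
      case mixed
      \<comment> \<open>The halves belonging to the even coordinate add up to \<open>n\<close>,
        those belonging to the odd one to \<open>n - 1\<close>. The total is odd, so the second
        binary digit of the Nim-sum is 1.\<close>
      then have "odd (i div 2 + (int m - 1 - i) div 2 + j div 2 + (int m - 1 - j) div 2)"
        using 4 by presburger
      then show ?thesis
        using mixed 4 by (metis even_nim_sum_iff even_zero nim_sum_div_2 odd_coeff_odd div_0)
    next
      case even
      \<comment> \<open>Here \<open>i\<close> and \<open>2 * n - i\<close> are both even, so their
        halves add up to \<open>n\<close>, which is the complement sum for index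
        \<open>Suc n\<close>.\<close>
      have "(int m - 1 - i) div 2 = int (Suc n) - 1 - i'"
        "(int m - 1 - j) div 2 = int (Suc n) - 1 - j'"
        "i \<in> {0..<int m} \<longleftrightarrow> i' \<in> {0..<int (Suc n)}"
        "j \<in> {0..<int m} \<longleftrightarrow> j' \<in> {0..<int (Suc n)}"
        using 4 even unfolding i'_def j'_def atLeastLessThan_iff by presburger+
      then show ?thesis
        using less.IH[of "Suc n" i' j'] 4 even par
        by (simp add: odd_coeff_odd nim_sum_eq_0_iff[of i] flip: i'_def j'_def)
    next
      case odd
      \<comment> \<open>Two odd numbers with sum \<open>2 * n\<close> lose 1 each before halving, so
        the halves add up to \<open>n - 1\<close> and the index is \<open>n\<close>.\<close>
      have "(int m - 1 - i) div 2 = int n - 1 - i'" "(int m - 1 - j) div 2 = int n - 1 - j'"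
        "i \<in> {0..<int m} \<longleftrightarrow> i' \<in> {0..<int n}" "j \<in> {0..<int m} \<longleftrightarrow> j' \<in> {0..<int n}"
        using 4 odd unfolding i'_def j'_def atLeastLessThan_iff by presburger+
      then show ?thesis
        using less.IH[of n i' j'] 4 odd par
        by (simp add: odd_coeff_odd nim_sum_eq_0_iff[of i] flip: i'_def j'_def)
    qed
  qed
qed

theorem theorem8:
  fixes m :: nat
  assumes "m > 0"
  shows "P_positions (int m) = {(i, j). [a m i j = 1] (mod 2)}"
proof -
  have "(i, j) \<in> P_positions (int m) \<longleftrightarrow> [a m i j = 1] (mod 2)" for i j
  proof -
    \<comment> \<open>Shifting by one turns the board coordinates \<open>1..m\<close> into
      \<open>0..m-1\<close>, with \<open>m - i\<close> as the complement of
      \<open>i - 1\<close>.\<close>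
    have "[a m i j = 1] (mod 2) \<longleftrightarrow> odd_coeff m (i - 1) (j - 1)"
      by (simp add: odd_coeff_def cong_def odd_iff_mod_2_eq_one)
    then show ?thesis
      by (auto simp: P_positions_iff odd_coeff_iff_nim_sum)
  qed
  then show ?thesis
    by auto
qed

end
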